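(* For any undirected weighted $n$-node graph $G$ and pair of nodes $(s,t)$, there is a $1$-FT $(s,t)$ preserver of $G$ with $O(n)$ edges.
   Context: A subgraph $H\subseteq G=(V,E)$ is a $1$-FT $(s,t)$ preserver if $\mathrm{dist}_{H\setminus F}(s,t)=\mathrm{dist}_{G\setminus F}(s,t)$ for every $F\subseteq E$ with $|F|\leq 1$ (distances w.r.t. edge weights). *)

theory Defs
  imports "Graph_Theory.Graph_Theory"
begin

record 'a ugraph =
  nodes :: "'a set"
  edges :: "'a set set"

definition fin_ugraph :: "'a ugraph \<Rightarrow> bool" where
  "fin_ugraph G \<longleftrightarrow> finite (nodes G) \<and> (\<forall>e \<in> edges G. e \<subseteq> nodes G \<and> card e = 2)"

definition ugraph_subgraph :: "'a ugraph \<Rightarrow> 'a ugraph \<Rightarrow> bool" where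
  "ugraph_subgraph H G \<longleftrightarrow>
     fin_ugraph H \<and> nodes H \<subseteq> nodes G \<and> edges H \<subseteq> edges G"

definition delete_edges :: "'a ugraph \<Rightarrow> 'a set set \<Rightarrow> 'a ugraph" where
  "delete_edges G F = G\<lparr>edges := edges G - F\<rparr>"

text \<open>Each edge \<open>{u, v}\<close> becomes the two arcs \<open>(u, v)\<close> and \<open>(v, u)\<close>, both of weight
  \<open>w {u, v}\<close>, so that walks and shortest-path distances can be taken in the digraph.\<close>

definition bidirect :: "'a ugraph \<Rightarrow> ('a, 'a \<times> 'a) pre_digraph" where
  "bidirect G =
     \<lparr>verts = nodes G, arcs = {(u, v). {u, v} \<in> edges G}, tail = fst, head = snd\<rparr>"

text \<open>The distance is the infimum of the weights of all walks. For nonnegative weights this is the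
  minimum weight of a path, and it is \<open>\<infinity>\<close> if \<open>t\<close> is not reachable from \<open>s\<close>.\<close>

definition udist :: "'a ugraph \<Rightarrow> ('a set \<Rightarrow> real) \<Rightarrow> 'a \<Rightarrow> 'a \<Rightarrow> ereal" where
  "udist G w s t = wf_digraph.\<mu> (bidirect G) (\<lambda>(u, v). w {u, v}) s t"

definition FT_preserver ::
    "nat \<Rightarrow> 'a ugraph \<Rightarrow> ('a set \<Rightarrow> real) \<Rightarrow> 'a \<Rightarrow> 'a \<Rightarrow> 'a ugraph \<Rightarrow> bool" where
  "FT_preserver f G w s t H \<longleftrightarrow>
     ugraph_subgraph H G \<and>
     (\<forall>F. F \<subseteq> edges G \<and> finite F \<and> card F \<le> f \<longrightarrow>
        udist (delete_edges H F) w s t = udist (delete_edges G F) w s t)"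

text \<open>The theory of \<open>wf_digraph.\<mu>\<close> applies only to well-formed digraphs.\<close>

lemma wf_digraph_bidirect: "fin_ugraph G \<Longrightarrow> wf_digraph (bidirect G)"
  by unfold_locales (auto simp: fin_ugraph_def bidirect_def)

lemma fin_ugraph_delete_edges: "fin_ugraph G \<Longrightarrow> fin_ugraph (delete_edges G F)"
  by (auto simp: fin_ugraph_def delete_edges_def)

end

theory Submission
  imports Defs
begin

text \<open>Assume first that all weights are positive, and let \<open>T\<^sub>s\<close> and \<open>T\<^sub>t\<close> be shortest-path trees rooted
  at \<open>s\<close> and \<open>t\<close>. If \<open>e\<close> fails and destroys the tree path from \<open>s\<close> to \<open>t\<close>, take the first edge \<open>{u, v}\<close>
  on a replacement path such that the tree path from \<open>s\<close> to \<open>v\<close> uses \<open>e\<close>. Then the tree path from \<open>s\<close>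
  to \<open>u\<close> avoids \<open>e\<close>, and so does the one from \<open>t\<close> to \<open>v\<close>, because \<open>v\<close> cannot lie behind \<open>e\<close> as seen
  from both ends. Hence \<open>T\<^sub>s\<close>, \<open>T\<^sub>t\<close> and one edge \<open>{u, v}\<close> for every \<open>e\<close> in \<open>T\<^sub>s\<close> suffice, which is at
  most \<open>3n\<close> edges. Edges of weight \<open>0\<close> would break the comparison of directions; they are handled by
  adding a small constant to all weights and passing to the limit.\<close>

section \<open>Weighted distances in finite undirected graphs\<close>

lemma verts_bidirect [simp]: "verts (bidirect G) = nodes G"
  and arcs_bidirect [simp]: "(u, v) \<in> arcs (bidirect G) \<longleftrightarrow> {u, v} \<in> edges G"
  and tail_bidirect [simp]: "tail (bidirect G) = fst"
  and head_bidirect [simp]: "head (bidirect G) = snd"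
  by (simp_all add: bidirect_def)

lemma fin_digraph_bidirect:
  assumes "fin_ugraph G"
  shows "fin_digraph (bidirect G)"
proof -
  interpret wf_digraph "bidirect G"
    using assms by (rule wf_digraph_bidirect)
  have "arcs (bidirect G) \<subseteq> nodes G \<times> nodes G"
    using assms by (auto simp: fin_ugraph_def bidirect_def)
  with assms show ?thesis
    by unfold_locales (auto simp: fin_ugraph_def bidirect_def elim: finite_subset)
qed

text \<open>Nonnegative weights allow cycles to be cut out of walks, so the infimum reduces to a
  minimum over the finitely many simple paths.\<close>

lemma udist_attained:
  assumes "fin_ugraph G" "\<forall>e \<in> edges G. 0 \<le> w e" "udist G w u v < \<infinity>"
  obtains p where "pre_digraph.apath (bidirect G) u p v"
    and "udist G w u v = ereal (\<Sum>(x, y)\<leftarrow>p. w {x, y})"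
proof -
  interpret fin_digraph "bidirect G"
    using assms(1) by (rule fin_digraph_bidirect)
  have "u \<rightarrow>\<^sup>*\<^bsub>bidirect G\<^esub> v"
    using assms(3) unfolding udist_def \<mu>_reach_conv .
  then have "\<exists>p. apath u p v \<and> \<mu> (\<lambda>(x, y). w {x, y}) u v = awalk_cost (\<lambda>(x, y). w {x, y}) p"
    using assms(2) by (intro min_cost_awalk) auto
  then show ?thesis
    using that by (auto simp: udist_def awalk_cost_def)
qed

lemma udist_nonneg:
  assumes "fin_ugraph G" "\<forall>e \<in> edges G. 0 \<le> w e"
  shows "0 \<le> udist G w u v"
proof -
  interpret fin_digraph "bidirect G"
    using assms(1) by (rule fin_digraph_bidirect)
  have "0 \<le> awalk_cost (\<lambda>(x, y). w {x, y}) p" if "awalk u p v" for p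
    using that assms(2) by (intro pos_cost_pos_awalk_cost) auto
  then show ?thesis
    by (auto simp: udist_def \<mu>_def intro!: INF_greatest)
qed

lemma udist_refl:
  assumes "fin_ugraph G" "\<forall>e \<in> edges G. 0 \<le> w e" "u \<in> nodes G"
  shows "udist G w u u = 0"
proof (rule antisym)
  interpret fin_digraph "bidirect G"
    using assms(1) by (rule fin_digraph_bidirect)
  have "awalk u [] u"
    using assms(3) by (simp add: awalk_Nil_iff)
  from min_cost_le_walk_cost[OF this] show "udist G w u u \<le> 0"
    by (simp add: udist_def zero_ereal_def)
qed (rule udist_nonneg[OF assms(1,2)])

lemma udist_step:
  assumes "fin_ugraph G" "\<forall>e \<in> edges G. 0 \<le> w e" "{u, v} \<in> edges G"
  shows "udist G w s v \<le> udist G w s u + ereal (w {u, v})"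
proof -
  interpret fin_digraph "bidirect G"
    using assms(1) by (rule fin_digraph_bidirect)
  show ?thesis
    using pos_cost_mu_triangle[of "\<lambda>(x, y). w {x, y}" "(u, v)" u v s] assms(2,3)
    by (auto simp: udist_def arc_to_ends_def)
qed

lemma udist_pred:
  assumes "fin_ugraph G" "\<forall>e \<in> edges G. 0 \<le> w e" "v \<noteq> s" "udist G w s v < \<infinity>"
  shows "\<exists>u. {u, v} \<in> edges G \<and> udist G w s v = udist G w s u + ereal (w {u, v})"
proof -
  interpret fin_digraph "bidirect G"
    using assms(1) by (rule fin_digraph_bidirect)
  have "s \<rightarrow>\<^sup>*\<^bsub>bidirect G\<^esub> v"
    using assms(4) unfolding udist_def \<mu>_reach_conv .
  moreover have "0 \<le> (\<lambda>(x, y). w {x, y}) e" if "e \<in> arcs (bidirect G)" for e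
    using that assms(2) by (cases e) auto
  ultimately obtain u e where "udist G w s v = udist G w s u + ereal ((\<lambda>(x, y). w {x, y}) e)"
    "arc e (u, v)"
    unfolding udist_def using assms(3) by (rule_tac mu_exact_triangle)
  then show ?thesis
    by (cases e) (auto simp: arc_def)
qed

text \<open>A walk can be reversed at equal cost because both arcs of an edge share its weight.
  Allowing a subgraph \<open>K\<close> makes one induction serve both symmetry
  (\<open>K = G\<close>) and monotonicity.\<close>

lemma udist_rev_le_walk:
  assumes "fin_ugraph G" "\<forall>e \<in> edges G. 0 \<le> w e" "fin_ugraph K" "edges K \<subseteq> edges G"
    "nodes K \<subseteq> nodes G" "pre_digraph.awalk (bidirect K) u p v"
  shows "udist G w v u \<le> ereal (\<Sum>(x, y)\<leftarrow>p. w {x, y})"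
proof -
  interpret fin_digraph "bidirect K"
    using assms(3) by (rule fin_digraph_bidirect)
  show ?thesis
    using assms(6)
  proof (induction p arbitrary: u)
    case Nil
    then show ?case
      using assms udist_refl[of G w u] by (auto simp: awalk_Nil_iff)
  next
    case (Cons a p)
    obtain x y where a: "a = (x, y)" by force
    have e: "{y, x} \<in> edges G" and u: "u = x" and "awalk y p v"
      using Cons.prems a assms(4) by (auto simp: awalk_Cons_iff  insert_commute)
    have "udist G w v x \<le> udist G w v y + ereal (w {y, x})"
      by (rule udist_step[OF assms(1,2) e])
    also have "\<dots> \<le> ereal (\<Sum>(x, y)\<leftarrow>p. w {x, y}) + ereal (w {y, x})"
      using Cons.IH[OF \<open>awalk y p v\<close>] by (rule add_right_mono)
    finally show ?case
      by (simp add: a u insert_commute add.commute)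
  qed
qed

lemma udist_sym:
  assumes "fin_ugraph G" "\<forall>e \<in> edges G. 0 \<le> w e"
  shows "udist G w u v = udist G w v u"
proof -
  have "udist G w v u \<le> udist G w u v" for u v
  proof (cases "udist G w u v < \<infinity>")
    case True
    then obtain p where "pre_digraph.apath (bidirect G) u p v"
      "udist G w u v = ereal (\<Sum>(x, y)\<leftarrow>p. w {x, y})"
      by (rule udist_attained[OF assms])
    then show ?thesis
      using udist_rev_le_walk[OF assms assms(1), of u p v] by (simp add: pre_digraph.apath_def)
  qed simp
  then show ?thesis by (simp add: antisym)
qed

lemma udist_antimono:
  assumes "fin_ugraph G" "\<forall>e \<in> edges G. 0 \<le> w e" "fin_ugraph K" "edges K \<subseteq> edges G"
    "nodes K \<subseteq> nodes G"
  shows "udist G w u v \<le> udist K w u v"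
proof (cases "udist K w u v < \<infinity>")
  case True
  moreover have "\<forall>e \<in> edges K. 0 \<le> w e"
    using assms(2,4) by blast
  ultimately obtain p where "pre_digraph.apath (bidirect K) u p v"
    "udist K w u v = ereal (\<Sum>(x, y)\<leftarrow>p. w {x, y})"
    by (auto intro: udist_attained[OF assms(3)])
  then show ?thesis
    using udist_rev_le_walk[OF assms, of u p v] udist_sym[OF assms(1,2), of u v]
    by (simp add: pre_digraph.apath_def)
qed simp

lemma udist_triangle:
  assumes "fin_ugraph G" "\<forall>e \<in> edges G. 0 \<le> w e"
  shows "udist G w x z \<le> udist G w x y + udist G w y z"
proof (cases "udist G w x y < \<infinity> \<and> udist G w y z < \<infinity>")
  case True
  interpret fin_digraph "bidirect G"
    using assms(1) by (rule fin_digraph_bidirect)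
  obtain p q where p: "awalk x p y" "udist G w x y = ereal (\<Sum>(x, y)\<leftarrow>p. w {x, y})"
    and q: "awalk y q z" "udist G w y z = ereal (\<Sum>(x, y)\<leftarrow>q. w {x, y})"
    using True assms by (metis udist_attained apath_def)
  have "awalk x (p @ q) z"
    using p q by (auto intro: awalk_appendI)
  from min_cost_le_walk_cost[OF this, of "\<lambda>(x, y). w {x, y}"] show ?thesis
    by (simp add: p q udist_def[symmetric] awalk_cost_def)
next
  case False
  \<comment> \<open>Neither summand is negative, so one infinite summand makes the right-hand side
    infinite.\<close>
  then show ?thesis
    using udist_nonneg[OF assms, of x y] udist_nonneg[OF assms, of y z] by auto
qed

text \<open>Every walk gets dearer by \<epsilon> per edge. A cheapest path may be taken simple, so
  it has at most as many edges as there are nodes.\<close>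

lemma udist_add_const:
  assumes G: "fin_ugraph G" and w: "\<forall>e \<in> edges G. 0 \<le> w e" and "0 \<le> \<epsilon>"
  shows "udist G w u v \<le> udist G (\<lambda>e. w e + \<epsilon>) u v"
    and "udist G (\<lambda>e. w e + \<epsilon>) u v \<le> udist G w u v + ereal (\<epsilon> * card (nodes G))"
proof -
  interpret fin_digraph "bidirect G"
    using G by (rule fin_digraph_bidirect)
  have cost: "(\<Sum>(x, y)\<leftarrow>p. w {x, y} + \<epsilon>) = (\<Sum>(x, y)\<leftarrow>p. w {x, y}) + \<epsilon> * length p"
    for p :: "('a \<times> 'a) list"
    by (induction p) (auto simp: algebra_simps)
  show "udist G w u v \<le> udist G (\<lambda>e. w e + \<epsilon>) u v"
    unfolding udist_def \<mu>_def awalk_cost_def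
    by (rule INF_mono) (use cost assms(3) in auto)
  show "udist G (\<lambda>e. w e + \<epsilon>) u v \<le> udist G w u v + ereal (\<epsilon> * card (nodes G))"
  proof (cases "udist G w u v < \<infinity>")
    case True
    then obtain p where p: "apath u p v" "udist G w u v = ereal (\<Sum>(x, y)\<leftarrow>p. w {x, y})"
      by (rule udist_attained[OF G w])
    have "length p \<le> card (nodes G)"
      using length_apath[OF p(1)] by simp
    then have "\<epsilon> * length p \<le> \<epsilon> * card (nodes G)"
      using assms(3) by (simp add: mult_left_mono)
    moreover have "udist G (\<lambda>e. w e + \<epsilon>) u v \<le> ereal (\<Sum>(x, y)\<leftarrow>p. w {x, y} + \<epsilon>)"
      using min_cost_le_walk_cost[of u p v "\<lambda>(x, y). w {x, y} + \<epsilon>"] p(1)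
      by (simp add: apath_def udist_def awalk_cost_def)
    ultimately show ?thesis
      by (simp add: p(2) cost order.trans)
  qed simp
qed

section \<open>Positive weights and shortest-path trees\<close>

locale pos_weighted_ugraph =
  fixes G :: "'a ugraph" and w :: "'a set \<Rightarrow> real"
  assumes fin_G: "fin_ugraph G" and pos: "e \<in> edges G \<Longrightarrow> 0 < w e"
begin

text \<open>Only the edge set varies: trees and graphs with failed edges are all compared on the
  full node set of \<open>G\<close>.\<close>

abbreviation d :: "'a set set \<Rightarrow> 'a \<Rightarrow> 'a \<Rightarrow> ereal" where
  "d E \<equiv> udist \<lparr>nodes = nodes G, edges = E\<rparr> w"

abbreviation "V \<equiv> nodes G"
abbreviation "A \<equiv> edges G"

lemma fin_sub: "E \<subseteq> A \<Longrightarrow> fin_ugraph \<lparr>nodes = V, edges = E\<rparr>"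
  using fin_G by (auto simp: fin_ugraph_def)

lemma nonneg_sub: "E \<subseteq> A \<Longrightarrow> \<forall>e \<in> edges \<lparr>nodes = V, edges = E\<rparr>. 0 \<le> w e"
  using pos by (auto simp: less_imp_le)

lemma edge_in_V: "{u, v} \<in> A \<Longrightarrow> u \<in> V \<and> v \<in> V"
  using fin_G by (auto simp: fin_ugraph_def)

lemma d_nonneg: "E \<subseteq> A \<Longrightarrow> 0 \<le> d E u v"
  using udist_nonneg[OF fin_sub nonneg_sub] .

lemma d_refl: "E \<subseteq> A \<Longrightarrow> u \<in> V \<Longrightarrow> d E u u = 0"
  using udist_refl[OF fin_sub nonneg_sub] by simp

lemma d_sym: "E \<subseteq> A \<Longrightarrow> d E u v = d E v u"
  using udist_sym[OF fin_sub nonneg_sub] .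

lemma d_step: "E \<subseteq> A \<Longrightarrow> {u, v} \<in> E \<Longrightarrow> d E s v \<le> d E s u + ereal (w {u, v})"
  using udist_step[OF fin_sub nonneg_sub] by simp

lemma d_pred:
  "E \<subseteq> A \<Longrightarrow> v \<noteq> s \<Longrightarrow> d E s v < \<infinity> \<Longrightarrow>
    \<exists>u. {u, v} \<in> E \<and> d E s v = d E s u + ereal (w {u, v})"
  using udist_pred[OF fin_sub nonneg_sub] by simp

lemma d_triangle: "E \<subseteq> A \<Longrightarrow> d E x z \<le> d E x y + d E y z"
  using udist_triangle[OF fin_sub nonneg_sub] .

lemma d_antimono: "E \<subseteq> E' \<Longrightarrow> E' \<subseteq> A \<Longrightarrow> d E' u v \<le> d E u v"
  by (rule udist_antimono) (use pos fin_sub in \<open>auto simp: less_imp_le\<close>)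

lemma d_real:
  assumes "E \<subseteq> A" "d E u v < \<infinity>"
  obtains r where "d E u v = ereal r" "0 \<le> r"
  using d_nonneg[OF assms(1), of u v] assms(2) by (cases "d E u v") auto

text \<open>Encodes a shortest-path tree rooted at \<open>s\<close> by choosing, for each reachable
  node, the last edge of some shortest path.\<close>

definition is_parent :: "'a \<Rightarrow> ('a \<Rightarrow> 'a) \<Rightarrow> bool" where
  "is_parent s p \<longleftrightarrow> (\<forall>v. v \<noteq> s \<and> d A s v < \<infinity> \<longrightarrow>
     {p v, v} \<in> A \<and> d A s v = d A s (p v) + ereal (w {p v, v}))"

definition tree :: "'a \<Rightarrow> ('a \<Rightarrow> 'a) \<Rightarrow> 'a set set" where
  "tree s p = (\<lambda>v. {p v, v}) ` {v \<in> V. v \<noteq> s \<and> d A s v < \<infinity>}"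

lemma ex_parent: "\<exists>p. is_parent s p"
proof -
  have "\<forall>v. \<exists>u. v \<noteq> s \<and> d A s v < \<infinity> \<longrightarrow>
     {u, v} \<in> A \<and> d A s v = d A s u + ereal (w {u, v})"
    using d_pred[OF order_refl] by blast
  then show ?thesis unfolding is_parent_def by metis
qed

lemma tree_subset: "is_parent s p \<Longrightarrow> tree s p \<subseteq> A"
  by (auto simp: is_parent_def tree_def)

lemma card_tree: "finite (tree s p)" "card (tree s p) \<le> card V"
proof -
  have "finite V" using fin_G by (simp add: fin_ugraph_def)
  then show "finite (tree s p)" by (simp add: tree_def)
  have "card (tree s p) \<le> card {v \<in> V. v \<noteq> s \<and> d A s v < \<infinity>}"
    unfolding tree_def using \<open>finite V\<close> by (intro card_image_le) simp
  also have "\<dots> \<le> card V" using \<open>finite V\<close> by (intro card_mono) auto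
  finally show "card (tree s p) \<le> card V" .
qed

text \<open>Positive weights make each step towards the root a strict descent. This drives the
  induction along tree paths and orients every tree edge.\<close>

lemma parent_closer:
  assumes "is_parent s p" "v \<noteq> s" "d A s v < \<infinity>"
  shows "d A s (p v) < d A s v" "p v \<in> V" "v \<in> V"
proof -
  have e: "{p v, v} \<in> A" and *: "d A s v = d A s (p v) + ereal (w {p v, v})"
    using assms by (auto simp: is_parent_def)
  show "p v \<in> V" "v \<in> V" using edge_in_V[OF e] by auto
  show "d A s (p v) < d A s v"
    using * assms(3) pos[OF e] d_nonneg[OF order_refl, of s "p v"] by (cases "d A s (p v)") auto
qed

text \<open>Follow the tree path from \<open>v\<close> up to \<open>s\<close>. Either it avoids
  \<open>F\<close> and realises the distance, or it meets a failed edge, whose lower end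
  \<open>b\<close> then lies on a shortest path from \<open>s\<close> to \<open>v\<close>.\<close>

lemma tree_dist_or_cut:
  assumes p: "is_parent s p" and s: "s \<in> V" and "v \<in> V"
  shows "d (tree s p - F) s v \<le> d A s v \<or>
    (\<exists>b. b \<noteq> s \<and> d A s b < \<infinity> \<and> {p b, b} \<in> F \<inter> tree s p \<and> d A s v = d A s b + d A b v)"
  using \<open>v \<in> V\<close>
proof (induction "card {u \<in> V. d A s u < d A s v}" arbitrary: v rule: less_induct)
  case less
  have T: "tree s p \<subseteq> A" "tree s p - F \<subseteq> A" using tree_subset[OF p] by auto
  consider "v = s" | "d A s v = \<infinity>" | "v \<noteq> s" "d A s v < \<infinity>"
    by (metis less_ereal.simps(1) ereal_infty_less(1))
  then show ?case
  proof cases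
    case 1
    then show ?thesis using d_refl[OF T(2) s] d_nonneg[OF order_refl] by auto
  next
    case 2
    then show ?thesis by simp
  next
    case 3
    let ?u = "p v"
    have e: "{?u, v} \<in> A" and dv: "d A s v = d A s ?u + ereal (w {?u, v})"
      using p 3 by (auto simp: is_parent_def)
    have eT: "{?u, v} \<in> tree s p" using 3 less.prems by (auto simp: tree_def)
    show ?thesis
    proof (cases "{?u, v} \<in> F")
      case True
      \<comment> \<open>The edge into \<open>v\<close> itself fails, so \<open>b\<close> is
        \<open>v\<close>.\<close>
      have "d A s v = d A s v + d A v v" using d_refl[OF order_refl less.prems] by simp
      then show ?thesis using True eT 3 by blast
    next
      case False
      have lt: "d A s ?u < d A s v" using parent_closer[OF p 3] by simp
      have "card {x \<in> V. d A s x < d A s ?u} < card {x \<in> V. d A s x < d A s v}"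
      proof (rule psubset_card_mono)
        show "finite {x \<in> V. d A s x < d A s v}" using fin_G by (simp add: fin_ugraph_def)
        show "{x \<in> V. d A s x < d A s ?u} \<subset> {x \<in> V. d A s x < d A s v}"
          using lt parent_closer(2)[OF p 3] by (auto simp: psubset_eq intro: less_trans)
      qed
      from less.hyps[OF this parent_closer(2)[OF p 3]] show ?thesis
      proof (elim disjE exE conjE)
        assume "d (tree s p - F) s ?u \<le> d A s ?u"
        then have "d (tree s p - F) s ?u + ereal (w {?u, v}) \<le> d A s v"
          unfolding dv by (rule add_right_mono)
        moreover have "d (tree s p - F) s v \<le> d (tree s p - F) s ?u + ereal (w {?u, v})"
          using False eT by (intro d_step T) auto
        ultimately show ?thesis by (blast intro: order_trans)
      next
        fix b assume b: "b \<noteq> s" "d A s b < \<infinity>" "{p b, b} \<in> F \<inter> tree s p"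
          "d A s ?u = d A s b + d A b ?u"
        \<comment> \<open>A node \<open>b\<close> found above the parent also serves
          \<open>v\<close>: its shortest path to the parent is prolonged by the last edge.\<close>
        have "d A s b + d A b v \<le> d A s b + (d A b ?u + ereal (w {?u, v}))"
          by (intro add_left_mono d_step e order_refl)
        also have "\<dots> = d A s v" by (simp add: dv b(4) add.assoc)
        finally have "d A s v = d A s b + d A b v"
          using d_triangle[OF order_refl, of s v b] by (intro antisym)
        then show ?thesis using b by blast
      qed
    qed
  qed
qed

text \<open>Two different lower ends of one edge would be parents of each other, hence each strictly
  closer to \<open>s\<close> than the other.\<close>

lemma cut_unique:
  assumes p: "is_parent s p" and b: "b \<noteq> s" "d A s b < \<infinity>" and c: "c \<noteq> s" "d A s c < \<infinity>"
    and eq: "{p b, b} = {p c, c}"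
  shows "b = c"
proof (rule ccontr)
  assume "b \<noteq> c"
  then have "p b = c" "p c = b" using eq by (auto simp: doubleton_eq_iff)
  then show False using parent_closer(1)[OF p b] parent_closer(1)[OF p c] by auto
qed

section \<open>Restoration after the failure of one edge\<close>

text \<open>If both \<open>t\<close> and \<open>v\<close> lie behind \<open>e\<close> as seen from \<open>s\<close>, then \<open>v\<close> does not lie behind \<open>e\<close> as
  seen from \<open>t\<close>: crossing \<open>e\<close> in the same direction as the paths from \<open>s\<close> would contradict
  minimality of the path from \<open>s\<close> to \<open>t\<close>, crossing it in the other one that of the path to \<open>v\<close>.\<close>

lemma not_cut_from_both_ends:
  assumes p: "is_parent s p" and q: "is_parent t q"
    and b: "b \<noteq> s" "d A s b < \<infinity>" "d A s t = d A s b + d A b t" "d A s v = d A s b + d A b v"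
    and c: "c \<noteq> t" "d A t c < \<infinity>" "d A t v = d A t c + d A c v"
    and eq: "{p b, b} = {q c, c}"
    and fin: "d A s v < \<infinity>"
  shows False
proof -
  have e: "{p b, b} \<in> A" and db: "d A s b = d A s (p b) + ereal (w {p b, b})"
    using p b(1,2) by (auto simp: is_parent_def)
  have dc: "d A t c = d A t (q c) + ereal (w {q c, c})"
    using q c(1,2) by (auto simp: is_parent_def)
  have W: "0 < w {p b, b}" by (rule pos[OF e])
  note nn = d_nonneg[OF order_refl]
  note tri = d_triangle[OF order_refl]
  consider "c = p b" "q c = b" | "c = b" "q c = p b"
    using eq by (auto simp: doubleton_eq_iff)
  then show False
  proof cases
    \<comment> \<open>The trees cross the edge in opposite directions. Minimality towards
      \<open>v\<close> from \<open>s\<close> and from \<open>t\<close> says that each end is closer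
      to \<open>v\<close> than the other by at least the edge weight.\<close>
    case 1
    have a: "d A s v \<le> d A s (p b) + d A (p b) v" "d A t v \<le> d A t b + d A b v"
      by (rule tri)+
    have c': "d A t v = d A t b + ereal (w {p b, b}) + d A (p b) v"
      using c(3) dc 1 eq by simp
    \<comment> \<open>Finiteness permits passing to reals, where common summands cancel.\<close>
    have f1: "d A s (p b) < \<infinity>" using db b(2) by auto
    have f2: "d A t b < \<infinity>" using dc c(2) 1 by auto
    have f3: "d A b v < \<infinity>" using b(4) fin nn[of s b] by auto
    have "d A t v < \<infinity>" using a(2) f2 f3 by (auto intro: le_less_trans)
    then have f4: "d A (p b) v < \<infinity>" using c' nn[of t b] by auto
    obtain x1 where x1: "d A s (p b) = ereal x1" using d_real[OF order_refl f1] .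
    obtain x2 where x2: "d A t b = ereal x2" using d_real[OF order_refl f2] .
    obtain x3 where x3: "d A b v = ereal x3" using d_real[OF order_refl f3] .
    obtain x4 where x4: "d A (p b) v = ereal x4" using d_real[OF order_refl f4] .
    have "x2 + w {p b, b} + x4 \<le> x2 + x3" using a(2) unfolding c' x2 x3 x4 by simp
    moreover have "x1 + w {p b, b} + x3 \<le> x1 + x4"
      using a(1) unfolding b(4) db x1 x3 x4 by simp
    ultimately show False using W by linarith
  next
    \<comment> \<open>Both trees enter \<open>b\<close> from \<open>p b\<close>. A shortest path
      from \<open>s\<close> to \<open>t\<close> through \<open>b\<close> would then save twice the
      edge weight by going from \<open>p b\<close> straight to \<open>t\<close>.\<close>
    case 2
    have a: "d A s t \<le> d A s (p b) + d A (p b) t" by (rule tri)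
    have f1: "d A s (p b) < \<infinity>" using db b(2) by auto
    have f2: "d A t (p b) < \<infinity>" using dc c(2) 2 by auto
    have f3: "d A b t < \<infinity>" using c(2) 2 d_sym[OF order_refl, of b t] by simp
    obtain x1 where x1: "d A s (p b) = ereal x1" using d_real[OF order_refl f1] .
    obtain x2 where x2: "d A t (p b) = ereal x2" using d_real[OF order_refl f2] .
    obtain x3 where x3: "d A b t = ereal x3" using d_real[OF order_refl f3] .
    have x2': "d A (p b) t = ereal x2" using x2 d_sym[OF order_refl, of t "p b"] by simp
    have "x1 + w {p b, b} + x3 \<le> x1 + x2"
      using a unfolding b(3) db x1 x2' x3 by simp
    moreover have "x3 = x2 + w {p b, b}"
      using dc x2 x3 d_sym[OF order_refl, of b t] 2 eq by simp
    ultimately show False using W by linarith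
  qed
qed

text \<open>In the main case a shortest path avoiding \<open>e\<close> is matched by a tree path
  from \<open>s\<close>, one edge \<open>g\<close>, and a tree path to \<open>t\<close>. The tree
  parts attain distances of \<open>G\<close>, which are at most those avoiding
  \<open>e\<close>.\<close>

lemma restoration:
  assumes p: "is_parent s p" and q: "is_parent t q" and s: "s \<in> V" and t: "t \<in> V" and e: "e \<in> A"
  shows "\<exists>g \<in> A. d ((tree s p \<union> tree t q \<union> {g}) - {e}) s t \<le> d (A - {e}) s t"
proof (cases "d (A - {e}) s t < \<infinity> \<and> \<not> d (tree s p - {e}) s t \<le> d A s t")
  case False
  then consider "d (A - {e}) s t = \<infinity>" | "d (tree s p - {e}) s t \<le> d A s t" by auto
  then show ?thesis
  proof cases
    case 1
    \<comment> \<open>Any edge would do; \<open>e\<close> is a dummy, added and removed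
      again.\<close>
    then show ?thesis using e by (intro bexI[of _ e]) simp_all
  next
    case 2
    have "d ((tree s p \<union> tree t q \<union> {e}) - {e}) s t \<le> d (tree s p - {e}) s t"
      using tree_subset[OF p] tree_subset[OF q] by (intro d_antimono) auto
    also note 2
    also have "d A s t \<le> d (A - {e}) s t" by (rule d_antimono) auto
    finally show ?thesis using e by (rule bexI)
  qed
next
  case True
  let ?B = "A - {e}"
  have B: "?B \<subseteq> A" by auto
  note le = d_antimono[OF B order_refl]
  define cut where "cut v \<longleftrightarrow> \<not> d (tree s p - {e}) s v \<le> d A s v" for v
  \<comment> \<open>Equality in the triangle inequality expresses that \<open>v\<close> lies on some
    shortest replacement path. A member of \<open>L\<close> closest to \<open>s\<close> plays the
    role of the first cut node.\<close>
  define L where "L = {v \<in> V. cut v \<and> d ?B s v + d ?B v t = d ?B s t}"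
  have "finite L" using fin_G by (simp add: L_def fin_ugraph_def)
  moreover have "t \<in> L" using True t d_refl[OF B t] by (simp add: L_def cut_def)
  ultimately obtain v where v: "v \<in> L" and min: "\<And>u. u \<in> L \<Longrightarrow> d ?B s v \<le> d ?B s u"
    using ex_min_if_finite[of "d ?B s ` L"] by (force simp: not_less)
  have vV: "v \<in> V" and cv: "cut v" and line: "d ?B s v + d ?B v t = d ?B s t"
    using v by (auto simp: L_def)
  have fv: "d ?B s v < \<infinity>" "d ?B v t < \<infinity>"
    using line True d_nonneg[OF B, of s v] d_nonneg[OF B, of v t] by auto
  have "v \<noteq> s"
  proof
    assume "v = s"
    moreover have "d (tree s p - {e}) s s = 0"
      using tree_subset[OF p] by (intro d_refl s) auto
    ultimately show False
      using cv d_nonneg[OF order_refl, of s s] by (simp add: cut_def)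
  qed
  then obtain u where u: "{u, v} \<in> ?B" "d ?B s v = d ?B s u + ereal (w {u, v})"
    using d_pred[OF B _ fv(1)] by blast
  have uvA: "{u, v} \<in> A" using u(1) by simp
  have fu: "d ?B s u < \<infinity>" using u(2) fv(1) by auto
  have lt: "d ?B s u < d ?B s v"
    using u(2) pos[OF uvA] fu d_nonneg[OF B, of s u] by (cases "d ?B s u") auto
  \<comment> \<open>The predecessor \<open>u\<close> stays on a shortest replacement path, so if it
    were cut it would be a member of \<open>L\<close> closer to \<open>s\<close> than
    \<open>v\<close>.\<close>
  have line': "d ?B s u + d ?B u t = d ?B s t"
  proof (rule antisym)
    have "d ?B t u \<le> d ?B t v + ereal (w {v, u})"
      using u(1) by (intro d_step B) (simp add: insert_commute)
    then have "d ?B u t \<le> ereal (w {u, v}) + d ?B v t"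
      using d_sym[OF B, of u t] d_sym[OF B, of v t] by (simp add: insert_commute add.commute)
    then have "d ?B s u + d ?B u t \<le> d ?B s u + (ereal (w {u, v}) + d ?B v t)"
      by (rule add_left_mono)
    also have "\<dots> = d ?B s t" by (simp add: line[symmetric] u(2) add.assoc)
    finally show "d ?B s u + d ?B u t \<le> d ?B s t" .
  qed (rule d_triangle[OF B])
  have "\<not> cut u"
  proof
    assume "cut u"
    then have "u \<in> L" using line' edge_in_V[OF uvA] by (simp add: L_def)
    then show False using min[of u] lt by (meson not_le)
  qed
  then have su: "d (tree s p - {e}) s u \<le> d A s u" by (simp add: cut_def)
  have tv: "d (tree t q - {e}) t v \<le> d A t v"
  proof (rule ccontr)
    assume "\<not> ?thesis"
    then obtain c where c: "c \<noteq> t" "d A t c < \<infinity>" "{q c, c} = e" "d A t v = d A t c + d A c v"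
      using tree_dist_or_cut[OF q t vV, of "{e}"] by auto
    obtain b where b: "b \<noteq> s" "d A s b < \<infinity>" "{p b, b} = e" "d A s v = d A s b + d A b v"
      using tree_dist_or_cut[OF p s vV, of "{e}"] cv by (auto simp: cut_def)
    obtain b' where b': "b' \<noteq> s" "d A s b' < \<infinity>" "{p b', b'} = e" "d A s t = d A s b' + d A b' t"
      using tree_dist_or_cut[OF p s t, of "{e}"] True by auto
    \<comment> \<open>The failed edge cuts both \<open>v\<close> and \<open>t\<close> off in the
      tree of \<open>s\<close>, with the same lower end, as the exclusion of a cut from both ends
      requires.\<close>
    have "b' = b" using cut_unique[OF p b'(1,2) b(1,2)] b(3) b'(3) by simp
    moreover have "d A s v < \<infinity>"
      using le[of s v] fv(1) by (rule le_less_trans)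
    ultimately show False
      using not_cut_from_both_ends[OF p q b(1,2) _ b(4) c(1,2,4)] b'(4) b(3) c(3) by simp
  qed
  let ?H = "(tree s p \<union> tree t q \<union> {{u, v}}) - {e}"
  have H: "?H \<subseteq> A" using tree_subset[OF p] tree_subset[OF q] uvA by auto
  have "d ?H s u \<le> d (tree s p - {e}) s u" by (rule d_antimono) (use H in auto)
  also note su
  also note le
  finally have 1: "d ?H s u \<le> d ?B s u" .
  have "d ?H t v \<le> d (tree t q - {e}) t v" by (rule d_antimono) (use H in auto)
  also note tv
  also note le
  finally have 2: "d ?H v t \<le> d ?B v t" by (simp only: d_sym[OF H, of v t] d_sym[OF B, of v t])
  have "d ?H s t \<le> d ?H s v + d ?H v t" by (rule d_triangle[OF H])
  also have "\<dots> \<le> (d ?H s u + ereal (w {u, v})) + d ?H v t"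
    by (intro add_right_mono d_step H) (use u(1) in auto)
  also have "\<dots> \<le> (d ?B s u + ereal (w {u, v})) + d ?B v t"
    by (intro add_mono 1 2 order_refl)
  also have "\<dots> = d ?B s t" using u(2) line by simp
  finally show ?thesis using uvA by blast
qed

lemma ex_FT_preserver:
  assumes s: "s \<in> V" and t: "t \<in> V"
  shows "\<exists>H. FT_preserver 1 G w s t H \<and> card (edges H) \<le> 3 * card V"
proof -
  obtain p q where p: "is_parent s p" and q: "is_parent t q" using ex_parent by blast
  obtain f where f: "\<And>e. e \<in> A \<Longrightarrow> f e \<in> A"
    "\<And>e. e \<in> A \<Longrightarrow> d ((tree s p \<union> tree t q \<union> {f e}) - {e}) s t \<le> d (A - {e}) s t"
    using restoration[OF p q s t] by metis
  note T = tree_subset[OF p] tree_subset[OF q]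
  \<comment> \<open>One restoring edge per edge of the tree of \<open>s\<close> is enough: every
    other failure leaves the tree path to \<open>t\<close> intact. Each of the three sets has at
    most \<open>card V\<close> edges.\<close>
  define E where "E = tree s p \<union> tree t q \<union> f ` tree s p"
  have E: "E \<subseteq> A" using T f(1) by (auto simp: E_def)
  have "card E \<le> card (tree s p \<union> tree t q) + card (f ` tree s p)"
    unfolding E_def by (rule card_Un_le)
  also have "card (tree s p \<union> tree t q) \<le> card (tree s p) + card (tree t q)"
    by (rule card_Un_le)
  also have "card (f ` tree s p) \<le> card (tree s p)"
    by (rule card_image_le[OF card_tree(1)])
  finally have card: "card E \<le> 3 * card V"
    using card_tree(2)[of s p] card_tree(2)[of t q] by linarith
  have "d (E - F) s t = d (A - F) s t" if F: "F \<subseteq> A" "finite F" "card F \<le> 1" for F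
  proof (rule antisym)
    show "d (A - F) s t \<le> d (E - F) s t" using E by (intro d_antimono) auto
    show "d (E - F) s t \<le> d (A - F) s t"
    proof (cases "d (tree s p - F) s t \<le> d A s t")
      case True
      have "d (E - F) s t \<le> d (tree s p - F) s t"
        using E by (intro d_antimono) (auto simp: E_def)
      also note True
      also have "d A s t \<le> d (A - F) s t" by (intro d_antimono) auto
      finally show ?thesis .
    next
      case False
      then obtain e where "e \<in> F" "e \<in> tree s p"
        using tree_dist_or_cut[OF p s t, of F] by blast
      \<comment> \<open>A failed tree edge already exhausts the failure budget of one.\<close>
      then have "F = {e}" using F by (auto simp: card_le_Suc0_iff_eq)
      have "d (E - {e}) s t \<le> d ((tree s p \<union> tree t q \<union> {f e}) - {e}) s t"
        using E \<open>e \<in> tree s p\<close> by (intro d_antimono) (auto simp: E_def)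
      also have "\<dots> \<le> d (A - {e}) s t"
        using T \<open>e \<in> tree s p\<close> by (intro f(2)) auto
      finally show ?thesis by (simp add: \<open>F = {e}\<close>)
    qed
  qed
  moreover have "delete_edges G F = \<lparr>nodes = V, edges = A - F\<rparr>"
    "delete_edges \<lparr>nodes = V, edges = E\<rparr> F = \<lparr>nodes = V, edges = E - F\<rparr>" for F
    by (cases G, simp_all add: delete_edges_def)
  ultimately have "FT_preserver 1 G w s t \<lparr>nodes = V, edges = E\<rparr>"
    using E fin_sub[OF E] by (simp add: FT_preserver_def ugraph_subgraph_def)
  then show ?thesis using card by (intro exI conjI) auto
qed

end

section \<open>From positive to nonnegative weights\<close>

text \<open>A subgraph that is a preserver for weights \<open>w + \<epsilon>\<close> with \<open>\<epsilon>\<close> arbitrarily small is a preserver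
  for \<open>w\<close>; since there are only finitely many subgraphs, some small one works for a sequence of
  \<open>\<epsilon>\<close> tending to \<open>0\<close>.\<close>

lemma FT_preserver_limit:
  assumes G: "fin_ugraph G" and w: "\<forall>e \<in> edges G. 0 \<le> w e"
    and H: "\<And>\<delta> :: real. 0 < \<delta> \<Longrightarrow> \<exists>\<epsilon>. 0 < \<epsilon> \<and> \<epsilon> < \<delta> \<and> FT_preserver f G (\<lambda>e. w e + \<epsilon>) s t H"
  shows "FT_preserver f G w s t H"
proof -
  have sub: "ugraph_subgraph H G"
    using H[of 1] by (auto simp: FT_preserver_def)
  have "udist (delete_edges H F) w s t = udist (delete_edges G F) w s t"
    if F: "F \<subseteq> edges G" "finite F" "card F \<le> f" for F
  proof -
    let ?H = "delete_edges H F" and ?G = "delete_edges G F"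
    let ?n = "card (nodes G)"
    have fH: "fin_ugraph ?H" and fG: "fin_ugraph ?G"
      using G sub by (simp_all add: fin_ugraph_delete_edges ugraph_subgraph_def)
    have wG: "\<forall>e \<in> edges ?G. 0 \<le> w e" and wH: "\<forall>e \<in> edges ?H. 0 \<le> w e"
      using w sub by (auto simp: delete_edges_def ugraph_subgraph_def)
    have "udist ?H w s t \<le> udist ?G w s t + ereal \<eta>" if "0 < \<eta>" for \<eta>
    proof -
      \<comment> \<open>The total perturbation \<epsilon> times \<open>?n\<close> stays below
        \<eta>; adding 1 keeps the denominator positive even for an empty node set.\<close>
      obtain \<epsilon> where \<epsilon>: "0 < \<epsilon>" "\<epsilon> < \<eta> / (?n + 1)" "FT_preserver f G (\<lambda>e. w e + \<epsilon>) s t H"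
        using H[of "\<eta> / (?n + 1)"] \<open>0 < \<eta>\<close> by auto
      have "\<epsilon> * ?n \<le> \<epsilon> * (?n + 1)" using \<epsilon>(1) by simp
      also have "\<dots> \<le> \<eta>" using \<epsilon>(2) by (simp add: field_simps)
      finally have small: "\<epsilon> * ?n \<le> \<eta>" .
      have "udist ?H w s t \<le> udist ?H (\<lambda>e. w e + \<epsilon>) s t"
        using \<epsilon>(1) by (intro udist_add_const fH wH) simp
      also have "\<dots> = udist ?G (\<lambda>e. w e + \<epsilon>) s t"
        using \<epsilon>(3) F by (simp add: FT_preserver_def)
      also have "\<dots> \<le> udist ?G w s t + ereal (\<epsilon> * card (nodes ?G))"
        using \<epsilon>(1) by (intro udist_add_const fG wG) simp
      also have "\<dots> \<le> udist ?G w s t + ereal \<eta>"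
        using small by (intro add_left_mono) (simp add: delete_edges_def)
      finally show ?thesis .
    qed
    then have "udist ?H w s t \<le> udist ?G w s t"
      by (rule ereal_le_epsilon2)
    moreover have "udist ?G w s t \<le> udist ?H w s t"
      using sub by (intro udist_antimono[OF fG wG fH])
        (auto simp: delete_edges_def ugraph_subgraph_def)
    ultimately show ?thesis by (rule antisym)
  qed
  then show ?thesis using sub by (simp add: FT_preserver_def)
qed

text \<open>Node and edge sets range over subsets of finite sets. This finiteness feeds the
  pigeonhole argument that fixes one preserver for infinitely many perturbations.\<close>

lemma finite_subgraphs:
  assumes "fin_ugraph G"
  shows "finite {H. ugraph_subgraph H G}"
proof (rule finite_subset)
  have "finite (nodes G)" using assms by (simp add: fin_ugraph_def)
  moreover have "edges G \<subseteq> Pow (nodes G)" using assms by (auto simp: fin_ugraph_def)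
  ultimately show "finite ((\<lambda>(N, E). \<lparr>nodes = N, edges = E\<rparr>) ` (Pow (nodes G) \<times> Pow (edges G)))"
    by (auto intro: finite_subset)
  show "{H. ugraph_subgraph H G} \<subseteq> (\<lambda>(N, E). \<lparr>nodes = N, edges = E\<rparr>) ` (Pow (nodes G) \<times> Pow (edges G))"
  proof
    fix H :: "'a ugraph" assume "H \<in> {H. ugraph_subgraph H G}"
    then show "H \<in> (\<lambda>(N, E). \<lparr>nodes = N, edges = E\<rparr>) ` (Pow (nodes G) \<times> Pow (edges G))"
      by (cases H) (auto simp: ugraph_subgraph_def)
  qed
qed

theorem theorem7:
  shows "\<exists>C :: real. \<forall>(G :: 'a ugraph) (w :: 'a set \<Rightarrow> real) (s :: 'a) (t :: 'a).
    fin_ugraph G \<and> (\<forall>e \<in> edges G. 0 \<le> w e) \<and> s \<in> nodes G \<and> t \<in> nodes G \<longrightarrow>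
    (\<exists>H. FT_preserver 1 G w s t H \<and> real (card (edges H)) \<le> C * real (card (nodes G)))"
proof (intro exI[of _ 3] allI impI)
  fix G :: "'a ugraph" and w :: "'a set \<Rightarrow> real" and s t :: 'a
  assume "fin_ugraph G \<and> (\<forall>e \<in> edges G. 0 \<le> w e) \<and> s \<in> nodes G \<and> t \<in> nodes G"
  then have G: "fin_ugraph G" and w: "\<forall>e \<in> edges G. 0 \<le> w e" and st: "s \<in> nodes G" "t \<in> nodes G"
    by auto
  let ?w = "\<lambda>k e. w e + 1 / real (Suc k)"
  have "\<exists>H. FT_preserver 1 G (?w k) s t H \<and> card (edges H) \<le> 3 * card (nodes G)" for k
  proof -
    interpret pos_weighted_ugraph G "?w k"
      using G w by unfold_locales (auto intro: add_nonneg_pos)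
    show ?thesis using st by (rule ex_FT_preserver)
  qed
  then obtain h where h: "\<And>k. FT_preserver 1 G (?w k) s t (h k)"
    "\<And>k. card (edges (h k)) \<le> 3 * card (nodes G)"
    by metis
  \<comment> \<open>Infinitely many indices share finitely many preservers, so some
    \<open>h k0\<close> recurs infinitely often, in particular for arbitrarily small
    perturbations.\<close>
  have "finite (range h)"
    using h(1) by (intro finite_subset[OF _ finite_subgraphs[OF G]]) (auto simp: FT_preserver_def)
  then obtain k0 where inf: "infinite {k. h k = h k0}"
    using pigeonhole_infinite[of UNIV h] by auto
  have "FT_preserver 1 G w s t (h k0)"
  proof (rule FT_preserver_limit[OF G w])
    fix \<delta> :: real assume "0 < \<delta>"
    then obtain n where n: "1 / real (Suc n) < \<delta>"
      using nat_approx_posE by blast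
    obtain k where k: "n < k" "h k = h k0"
      using inf by (auto simp: infinite_nat_iff_unbounded)
    have "1 / real (Suc k) \<le> 1 / real (Suc n)" using k(1) by (simp add: frac_le)
    then show "\<exists>\<epsilon>>0. \<epsilon> < \<delta> \<and> FT_preserver 1 G (\<lambda>e. w e + \<epsilon>) s t (h k0)"
      using h(1)[of k] k(2) n by (intro exI[of _ "1 / real (Suc k)"]) auto
  qed
  moreover have "real (card (edges (h k0))) \<le> 3 * real (card (nodes G))"
    using h(2)[of k0] by linarith
  ultimately show "\<exists>H. FT_preserver 1 G w s t H \<and> real (card (edges H)) \<le> 3 * real (card (nodes G))"
    by blast
qed

end
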